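(* Let $n\ge 4$, let $q_1,\dots,q_n\in\mathbb{H}$, put $q_0=0$ and $v_j=q_jq_n-q_{j-1}$ for $j=1,\dots,n$, and let $$P_r(z)=z^{n+1}-z^{n-1}v_n-z^{n-2}v_{n-1}-\cdots-zv_2-v_1 .$$ Let $w_1,\dots,w_{n+1}$ be positive real numbers and let $\gamma=\max\left\{\frac{w_1}{w_2},\frac{w_2}{w_3},\dots,\frac{w_{n-2}}{w_{n-1}}\right\}$. If $z\in\mathbb{H}$ is any zero of $P_r$, then $$|z|\le \frac12\left(\max\left\{\frac{w_n}{w_{n+1}},\frac{w_{n+1}}{w_n}|v_n|\right\}+\gamma\right)+\sqrt{\left(\max\left\{\frac{w_n}{w_{n+1}},\frac{w_{n+1}}{w_n}|v_n|\right\}-\gamma\right)^2+4\,\frac{w_{n-1}}{w_n}\sqrt{\sum_{j=1}^{n-1}|v_j|^2\left(\frac{w_{n+1}}{w_j}\right)^2}}\;.$$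
   Context: $\mathbb{H}=\{a+bi+cj+dk: a,b,c,d\in\mathbb{R}\}$ is the skew field of real quaternions, with modulus $|a+bi+cj+dk|=\sqrt{a^2+b^2+c^2+d^2}$. A right quaternionic polynomial has its coefficients to the right of the powers of the variable; $\sum_i z^ic_i$ is evaluated at $z\in\mathbb{H}$ using quaternion multiplication, and a zero is a $z\in\mathbb{H}$ at which the value is $0$. The polynomial $P_r$ is the auxiliary polynomial attached to the right polynomial $f_{r_1}(z)=z^n+z^{n-1}q_n+\cdots+zq_2+q_1$: it equals the convolution product $f_{r_1}*(z-q_n)$, where $\left(\sum_i z^ia_i\right)*\left(\sum_j z^jb_j\right)=\sum_{i,j}z^{i+j}a_ib_j$. *)

theory Defs
  imports "HOL-Analysis.Inner_Product" "HOL-Computational_Algebra.Polynomial"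
begin

text \<open>\<open>Quat a b c d\<close> is the quaternion \<open>a + bi + cj + dk\<close>.\<close>

datatype quat = Quat (qre: real) (qi: real) (qj: real) (qk: real)

lemma quat_eq_iff: "x = y \<longleftrightarrow> qre x = qre y \<and> qi x = qi y \<and> qj x = qj y \<and> qk x = qk y"
  by (cases x; cases y) auto

instantiation quat :: ab_group_add
begin
definition "0 = Quat 0 0 0 0"
definition "x + y = Quat (qre x + qre y) (qi x + qi y) (qj x + qj y) (qk x + qk y)"
definition "- x = Quat (- qre x) (- qi x) (- qj x) (- qk x)"
definition "x - y = Quat (qre x - qre y) (qi x - qi y) (qj x - qj y) (qk x - qk y)"
instance
  by standard
    (simp_all add: quat_eq_iff zero_quat_def plus_quat_def uminus_quat_def minus_quat_def)
end

lemma quat_add_sel [simp]: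
  "qre 0 = 0" "qi 0 = 0" "qj 0 = 0" "qk 0 = 0"
  "qre (x + y) = qre x + qre y" "qi (x + y) = qi x + qi y"
  "qj (x + y) = qj x + qj y" "qk (x + y) = qk x + qk y"
  "qre (- x) = - qre x" "qi (- x) = - qi x" "qj (- x) = - qj x" "qk (- x) = - qk x"
  "qre (x - y) = qre x - qre y" "qi (x - y) = qi x - qi y"
  "qj (x - y) = qj x - qj y" "qk (x - y) = qk x - qk y"
  by (simp_all add: zero_quat_def plus_quat_def uminus_quat_def minus_quat_def)

instantiation quat :: ring_1
begin
definition "1 = Quat 1 0 0 0"
definition "x * y = Quat
  (qre x * qre y - qi x * qi y - qj x * qj y - qk x * qk y)
  (qre x * qi y + qi x * qre y + qj x * qk y - qk x * qj y)
  (qre x * qj y - qi x * qk y + qj x * qre y + qk x * qi y)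
  (qre x * qk y + qi x * qj y - qj x * qi y + qk x * qre y)"
instance
  by standard (simp_all add: quat_eq_iff one_quat_def times_quat_def algebra_simps)
end

lemma quat_mult_sel [simp]:
  "qre 1 = 1" "qi 1 = 0" "qj 1 = 0" "qk 1 = 0"
  "qre (x * y) = qre x * qre y - qi x * qi y - qj x * qj y - qk x * qk y"
  "qi (x * y) = qre x * qi y + qi x * qre y + qj x * qk y - qk x * qj y"
  "qj (x * y) = qre x * qj y - qi x * qk y + qj x * qre y + qk x * qi y"
  "qk (x * y) = qre x * qk y + qi x * qj y - qj x * qi y + qk x * qre y"
  by (simp_all add: one_quat_def times_quat_def)

instantiation quat :: real_algebra_1
begin
definition "scaleR r x = Quat (r * qre x) (r * qi x) (r * qj x) (r * qk x)"
instance
  by standard (simp_all add: quat_eq_iff scaleR_quat_def algebra_simps)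
end

lemma quat_scaleR_sel [simp]:
  "qre (scaleR r x) = r * qre x" "qi (scaleR r x) = r * qi x"
  "qj (scaleR r x) = r * qj x" "qk (scaleR r x) = r * qk x"
  by (simp_all add: scaleR_quat_def)

instantiation quat :: real_inner
begin
definition "inner x y = qre x * qre y + qi x * qi y + qj x * qj y + qk x * qk y"
definition "norm x = sqrt ((qre x)\<^sup>2 + (qi x)\<^sup>2 + (qj x)\<^sup>2 + (qk x)\<^sup>2)"
definition "sgn x = scaleR (inverse (norm x)) x" for x :: quat
definition "dist x y = norm (x - y)" for x y :: quat
definition [code del]:
  "(uniformity :: (quat \<times> quat) filter) = (INF e\<in>{0 <..}. principal {(x, y). dist x y < e})"
definition [code del]:
  "open (U :: quat set) \<longleftrightarrow> (\<forall>x\<in>U. \<forall>\<^sub>F (x', y) in uniformity. x' = x \<longrightarrow> y \<in> U)"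
instance
proof
  fix x y z :: quat and r :: real
  show "inner x y = inner y x" "inner (x + y) z = inner x z + inner y z"
    "inner (scaleR r x) y = r * inner x y"
    by (simp_all add: inner_quat_def algebra_simps)
  show "0 \<le> inner x x" by (simp add: inner_quat_def)
  show "inner x x = 0 \<longleftrightarrow> x = 0"
    by (simp add: inner_quat_def quat_eq_iff add_nonneg_eq_0_iff)
  show "norm x = sqrt (inner x x)"
    by (simp add: inner_quat_def norm_quat_def power2_eq_square)
qed (simp_all only: sgn_quat_def dist_quat_def uniformity_quat_def open_quat_def)
end

instantiation quat :: real_normed_div_algebra
begin
definition "inverse x = scaleR (inverse ((norm x)\<^sup>2)) (Quat (qre x) (- qi x) (- qj x) (- qk x))"
definition "x div y = x * inverse y" for x y :: quat
instance
proof
  fix x y :: quat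
  have sq: "(norm z)\<^sup>2 = (qre z)\<^sup>2 + (qi z)\<^sup>2 + (qj z)\<^sup>2 + (qk z)\<^sup>2" for z :: quat
    by (simp add: norm_quat_def)
  show "inverse x * x = 1" "x * inverse x = 1" if "x \<noteq> 0"
  proof -
    define N where "N = (norm x)\<^sup>2"
    have "N \<noteq> 0" using that by (simp add: N_def)
    moreover have "N = qre x * qre x + qi x * qi x + qj x * qj x + qk x * qk x"
      unfolding N_def sq by (simp add: power2_eq_square)
    ultimately show "inverse x * x = 1" "x * inverse x = 1"
      unfolding inverse_quat_def N_def[symmetric]
      by (simp_all add: quat_eq_iff field_simps)
  qed
  show "inverse (0::quat) = 0" by (simp add: inverse_quat_def)
  show "x div y = x * inverse y" by (simp add: divide_quat_def)
  have "(norm (x * y))\<^sup>2 = (norm x * norm y)\<^sup>2"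
    unfolding power_mult_distrib sq by (simp add: power2_eq_square algebra_simps)
  then show "norm (x * y) = norm x * norm y" by simp
qed
end

text \<open>The library's \<open>poly\<close> needs commutative coefficients, so evaluation with the
  coefficients on the right of the powers of the variable is defined here.\<close>

definition right_eval :: "'a::ring_1 poly \<Rightarrow> 'a \<Rightarrow> 'a" where
  "right_eval p z = (\<Sum>i\<le>degree p. z ^ i * coeff p i)"

lemma right_eval_altdef:
  assumes "degree p \<le> d"
  shows "right_eval p z = (\<Sum>i\<le>d. z ^ i * coeff p i)"
  unfolding right_eval_def
  by (rule sum.mono_neutral_left) (use assms in \<open>auto simp: coeff_eq_0\<close>)

lemma right_eval_diff: "right_eval (p - r) z = right_eval p z - right_eval r z"
proof -
  define d where "d = max (degree p) (degree r)"
  have "degree (p - r) \<le> d" "degree p \<le> d" "degree r \<le> d"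
    using degree_diff_le_max[of p r] by (simp_all add: d_def)
  then show ?thesis by (simp add: right_eval_altdef[of _ d] algebra_simps sum_subtractf)
qed

lemma right_eval_add: "right_eval (p + r) z = right_eval p z + right_eval r z"
proof -
  define d where "d = max (degree p) (degree r)"
  have "degree (p + r) \<le> d" "degree p \<le> d" "degree r \<le> d"
    using degree_add_le_max[of p r] by (simp_all add: d_def)
  then show ?thesis by (simp add: right_eval_altdef[of _ d] algebra_simps sum.distrib)
qed

lemma right_eval_monom [simp]: "right_eval (monom c k) z = z ^ k * c"
proof -
  have "right_eval (monom c k) z = (\<Sum>i\<le>k. z ^ i * (if k = i then c else 0))"
    by (simp add: right_eval_altdef[OF degree_monom_le])
  also have "\<dots> = (\<Sum>i\<le>k. if k = i then z ^ i * c else 0)"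
    by (rule sum.cong) auto
  finally show ?thesis by simp
qed

lemma right_eval_sum: "right_eval (\<Sum>i\<in>A. p i) z = (\<Sum>i\<in>A. right_eval (p i) z)"
proof (induction A rule: infinite_finite_induct)
  case (insert x F)
  then show ?case by (simp add: right_eval_add)
qed (simp_all add: right_eval_def)

end

theory Submission
  imports Defs "HOL-Analysis.L2_Norm"
begin

text \<open>A zero \<open>z\<close> makes the weighted powers \<open>y\<^sub>j = w\<^sub>j |z|\<^sup>j\<^sup>-\<^sup>1\<close> behave like a left eigenvector, of
  eigenvalue \<open>|z|\<close>, of the weighted companion matrix of the polynomial. Splitting off the last two
  coordinates gives a 2-by-2 block matrix, whose diagonal blocks have norms at most the maximum in
  the statement and \<open>\<gamma>\<close>; taking the Euclidean norms of the two parts of \<open>y\<close> bounds \<open>|z|\<close> by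
  the spectral radius of the 2-by-2 matrix of block norms. This even yields the bound with the
  square root halved.\<close>

text \<open>The bound is the larger root of the characteristic polynomial
  \<open>(t - a) * (t - d) - b * c\<close>. Since \<open>b * c\<close> is nonnegative, this root
  dominates both diagonal entries; a \<open>t\<close> above both of them satisfies
  \<open>(t - a) * (t - d) \<le> b * c\<close>, by eliminating \<open>y\<close> from the two
  rows.\<close>

lemma nonneg_matrix_2_radius_bound:
  fixes t a b c d x y :: real
  assumes row1: "t * x \<le> a * x + b * y" and row2: "t * y \<le> c * x + d * y"
    and "x > 0" "b \<ge> 0" "c \<ge> 0"
  shows "t \<le> (a + d + sqrt ((a - d)\<^sup>2 + 4 * c * b)) / 2"
proof (cases "t \<le> max a d")
  case True
  have "\<bar>a - d\<bar> \<le> sqrt ((a - d)\<^sup>2 + 4 * c * b)"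
    using assms by (intro real_le_rsqrt) simp
  with True show ?thesis by (simp add: max_def split: if_splits; linarith)
next
  case False
  have "(t - d) * ((t - a) * x) \<le> (t - d) * (b * y)"
    using row1 False by (intro mult_left_mono) (auto simp: algebra_simps)
  also have "\<dots> = b * ((t - d) * y)" by simp
  also have "\<dots> \<le> b * (c * x)"
    using row2 \<open>b \<ge> 0\<close> by (intro mult_left_mono) (auto simp: algebra_simps)
  finally have "((t - d) * (t - a)) * x \<le> (b * c) * x" by (simp add: mult.assoc)
  then have "(t - d) * (t - a) \<le> b * c" using \<open>x > 0\<close> by simp
  \<comment> \<open>Completing the square: the left side equals the square of \<open>a - d\<close>
    plus \<open>4 * (t - d) * (t - a)\<close>.\<close>
  then have "(2 * t - (a + d))\<^sup>2 \<le> (a - d)\<^sup>2 + 4 * c * b"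
    by (simp add: power2_eq_square algebra_simps)
  then have "2 * t - (a + d) \<le> sqrt ((a - d)\<^sup>2 + 4 * c * b)" by (rule real_le_rsqrt)
  then show ?thesis by simp
qed

text \<open>Cauchy-Schwarz for signed terms, with explicit square roots to match \<open>s\<close>
  and \<open>Y2\<close> below.\<close>

lemma sum_mult_le_L2:
  fixes f g :: "'a \<Rightarrow> real"
  shows "(\<Sum>i\<in>A. f i * g i) \<le> sqrt (\<Sum>i\<in>A. (f i)\<^sup>2) * sqrt (\<Sum>i\<in>A. (g i)\<^sup>2)"
proof -
  have "(\<Sum>i\<in>A. f i * g i) \<le> (\<Sum>i\<in>A. \<bar>f i\<bar> * \<bar>g i\<bar>)"
    by (intro sum_mono) (metis abs_ge_self abs_mult)
  also have "\<dots> \<le> L2_set f A * L2_set g A" by (rule L2_set_mult_ineq)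
  finally show ?thesis by (simp add: L2_set_def)
qed

text \<open>The real-variable core: \<open>t\<close> and \<open>u j\<close> stand for
  \<open>norm z\<close> and \<open>norm (v j)\<close>, and \<open>zero\<close> is what the triangle
  inequality retains of the equation for \<open>z\<close>.\<close>

lemma cauchy_polynomial_bound:
  fixes t \<gamma> :: real and u w :: "nat \<Rightarrow> real"
  assumes "n \<ge> 2" and t: "t \<ge> 0" and w: "\<And>j. j \<in> {1..n + 1} \<Longrightarrow> w j > 0"
    and \<gamma>: "\<And>j. j \<in> {1..n - 2} \<Longrightarrow> w j / w (j + 1) \<le> \<gamma>" and "\<gamma> \<ge> 0"
    and zero: "t ^ (n + 1) \<le> (\<Sum>j=1..n. t ^ (j - 1) * u j)"
  defines "\<alpha> \<equiv> max (w n / w (n + 1)) (w (n + 1) / w n * u n)"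
    and "s \<equiv> sqrt (\<Sum>j=1..n - 1. (u j)\<^sup>2 * (w (n + 1) / w j)\<^sup>2)"
  shows "t \<le> (\<alpha> + \<gamma> + sqrt ((\<alpha> - \<gamma>)\<^sup>2 + 4 * (w (n - 1) / w n) * s)) / 2"
proof (cases "t = 0")
  \<comment> \<open>Treated apart because \<open>Y1\<close> below would vanish, and the matrix lemma
    divides by it.\<close>
  case True
  have "w n > 0" "w (n + 1) > 0" "w (n - 1) > 0"
    by (intro w; use \<open>n \<ge> 2\<close> in force)+
  moreover have "s \<ge> 0" by (simp add: s_def sum_nonneg)
  ultimately have "\<alpha> \<ge> 0" "sqrt ((\<alpha> - \<gamma>)\<^sup>2 + 4 * (w (n - 1) / w n) * s) \<ge> 0"
    unfolding \<alpha>_def by (auto simp: le_max_iff_disj)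
  then show ?thesis using True \<open>\<gamma> \<ge> 0\<close> by simp
next
  case False
  with t have "t > 0" by simp
  obtain k where n: "n = Suc (Suc k)" using \<open>n \<ge> 2\<close> by (metis add_2_eq_Suc le_Suc_ex)
  define y where "y j = w j * t ^ (j - 1)" for j
  have y_pos: "y j > 0" if "j \<in> {1..n + 1}" for j
    using w[OF that] \<open>t > 0\<close> by (simp add: y_def)
  have w_pos: "w n > 0" "w (Suc n) > 0" "w (Suc k) > 0" using w n by auto
  \<comment> \<open>These are the shift rows of the weighted companion matrix; \<open>zero\<close>
    will supply the last row.\<close>
  have step: "t * y j = w j / w (j + 1) * y (j + 1)" if "j \<in> {1..n}" for j
    using that w[of "j + 1"] by (cases j) (auto simp: y_def)
  define Y1 where "Y1 = sqrt ((y n)\<^sup>2 + (y (n + 1))\<^sup>2)"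
  define Y2 where "Y2 = sqrt (\<Sum>j=1..n - 1. (y j)\<^sup>2)"
  define \<beta> where "\<beta> = w (n - 1) / w n"
  have "\<beta> \<ge> 0" using w_pos by (simp add: \<beta>_def n)
  have "\<alpha> \<ge> 0" using w_pos by (auto simp: \<alpha>_def le_max_iff_disj)
  have "s \<ge> 0" "Y2 \<ge> 0" by (simp_all add: s_def Y2_def sum_nonneg)
  have yn: "y n > 0" "y (n + 1) > 0" using y_pos n by auto
  have "Y1 > 0" using yn by (simp add: Y1_def add_pos_pos)
  have Y1_sq: "Y1\<^sup>2 = (y n)\<^sup>2 + (y (n + 1))\<^sup>2" by (simp add: Y1_def)
  have Y2_sq: "Y2\<^sup>2 = (\<Sum>j=1..n - 1. (y j)\<^sup>2)" by (simp add: Y2_def sum_nonneg)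
  have "y n \<le> Y1" by (simp add: Y1_def real_le_rsqrt)

  \<comment> \<open>In the last row, the term \<open>j = n\<close> belongs to the diagonal block and
    is absorbed by \<alpha>; Cauchy-Schwarz bounds the others by \<open>s * Y2\<close>.\<close>
  have "t * y (n + 1) = w (n + 1) * t ^ (n + 1)" by (simp add: y_def)
  also have "\<dots> \<le> w (n + 1) * (\<Sum>j=1..n. t ^ (j - 1) * u j)"
    using zero w_pos by (intro mult_left_mono) auto
  also have "\<dots> = (\<Sum>j=1..n. (w (n + 1) / w j * u j) * y j)"
    unfolding sum_distrib_left
  proof (rule sum.cong)
    fix j assume "j \<in> {1..n}"
    with w[of j] show "w (n + 1) * (t ^ (j - 1) * u j) = (w (n + 1) / w j * u j) * y j"
      by (simp add: y_def)
  qed simp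
  also have "\<dots> = (\<Sum>j=1..n - 1. (w (n + 1) / w j * u j) * y j) + w (n + 1) / w n * u n * y n"
    by (simp add: n)
  also have "\<dots> \<le> s * Y2 + \<alpha> * y n"
  proof (rule add_mono)
    show "(\<Sum>j=1..n - 1. (w (n + 1) / w j * u j) * y j) \<le> s * Y2"
      using sum_mult_le_L2[of "\<lambda>j. w (n + 1) / w j * u j" y "{1..n - 1}"]
      unfolding s_def Y2_def power_mult_distrib by (simp add: mult.commute)
    show "w (n + 1) / w n * u n * y n \<le> \<alpha> * y n"
      using yn by (intro mult_right_mono) (auto simp: \<alpha>_def)
  qed
  finally have last: "t * y (n + 1) \<le> s * Y2 + \<alpha> * y n" .
  have "w n / w (n + 1) * y (n + 1) \<le> \<alpha> * y (n + 1)"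
    using yn by (intro mult_right_mono) (auto simp: \<alpha>_def)
  then have next_to_last: "t * y n \<le> \<alpha> * y (n + 1)"
    using step[of n] \<open>n \<ge> 2\<close> by simp
  \<comment> \<open>The block on coordinates \<open>n\<close> and \<open>n + 1\<close> has zero
    diagonal, so the larger of its two entries bounds its norm. The cross term contains only
    \<open>y n\<close>, and \<open>y n \<le> Y1\<close> completes the square.\<close>
  have "(t * Y1)\<^sup>2 = (t * y n)\<^sup>2 + (t * y (n + 1))\<^sup>2"
    unfolding power_mult_distrib Y1_sq by (simp add: algebra_simps)
  also have "\<dots> \<le> (\<alpha> * y (n + 1))\<^sup>2 + (s * Y2 + \<alpha> * y n)\<^sup>2"
    using next_to_last last yn t by (intro add_mono power_mono) auto
  also have "\<dots> = \<alpha>\<^sup>2 * Y1\<^sup>2 + 2 * (\<alpha> * (s * Y2)) * y n + (s * Y2)\<^sup>2"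
    unfolding Y1_sq by (simp add: power2_eq_square algebra_simps)
  also have "\<dots> \<le> \<alpha>\<^sup>2 * Y1\<^sup>2 + 2 * (\<alpha> * (s * Y2)) * Y1 + (s * Y2)\<^sup>2"
    using \<open>y n \<le> Y1\<close> \<open>\<alpha> \<ge> 0\<close> \<open>s \<ge> 0\<close> \<open>Y2 \<ge> 0\<close>
    by (intro add_mono mult_left_mono) auto
  also have "\<dots> = (\<alpha> * Y1 + s * Y2)\<^sup>2"
    by (simp add: power2_sum power_mult_distrib mult_ac)
  finally have "(t * Y1)\<^sup>2 \<le> (\<alpha> * Y1 + s * Y2)\<^sup>2" .
  then have row1: "t * Y1 \<le> \<alpha> * Y1 + s * Y2"
    by (rule power2_le_imp_le) (use \<open>\<alpha> \<ge> 0\<close> \<open>s \<ge> 0\<close> \<open>Y1 > 0\<close> \<open>Y2 \<ge> 0\<close> in simp)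

  \<comment> \<open>Coordinates up to \<open>k = n - 2\<close> are shifted within the first block,
    at cost \<gamma>; only coordinate \<open>n - 1\<close> is sent to the second block, with weight
    \<beta>.\<close>
  have "(t * Y2)\<^sup>2 = (\<Sum>j=1..k. (t * y j)\<^sup>2) + (t * y (n - 1))\<^sup>2"
    unfolding power_mult_distrib Y2_sq by (simp add: n sum_distrib_left distrib_left)
  also have "\<dots> \<le> (\<Sum>j=1..k. (\<gamma> * y (j + 1))\<^sup>2) + (\<beta> * Y1)\<^sup>2"
  proof (intro add_mono sum_mono power_mono)
    fix j assume "j \<in> {1..k}"
    then have "w j / w (j + 1) * y (j + 1) \<le> \<gamma> * y (j + 1)"
      using \<gamma>[of j] y_pos[of "j + 1"] n by (intro mult_right_mono) auto
    then show "t * y j \<le> \<gamma> * y (j + 1)" using step[of j] \<open>j \<in> {1..k}\<close> n by simp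
    show "0 \<le> t * y j" using \<open>j \<in> {1..k}\<close> y_pos[of j] t n by simp
  next
    have "\<beta> * y n \<le> \<beta> * Y1" using \<open>y n \<le> Y1\<close> \<open>\<beta> \<ge> 0\<close> by (rule mult_left_mono)
    then show "t * y (n - 1) \<le> \<beta> * Y1" using step[of "n - 1"] by (simp add: \<beta>_def n)
    show "0 \<le> t * y (n - 1)" using y_pos[of "n - 1"] t n by simp
  qed
  also have "(\<Sum>j=1..k. (\<gamma> * y (j + 1))\<^sup>2) = \<gamma>\<^sup>2 * (\<Sum>j=2..Suc k. (y j)\<^sup>2)"
    unfolding power_mult_distrib sum_distrib_left[symmetric]
    using sum.shift_bounds_cl_Suc_ivl[of "\<lambda>j. (y j)\<^sup>2" 1 k] by (simp add: numeral_2_eq_2)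
  \<comment> \<open>The shifted indices still lie in \<open>{1..n - 1}\<close>, as
    \<open>n - 1 = Suc k\<close>.\<close>
  also have "\<dots> \<le> \<gamma>\<^sup>2 * Y2\<^sup>2"
    unfolding Y2_sq n by (intro mult_left_mono sum_mono2) auto
  finally have "(t * Y2)\<^sup>2 \<le> \<gamma>\<^sup>2 * Y2\<^sup>2 + (\<beta> * Y1)\<^sup>2" by simp
  also have "\<dots> \<le> \<gamma>\<^sup>2 * Y2\<^sup>2 + (\<beta> * Y1)\<^sup>2 + 2 * (\<beta> * Y1) * (\<gamma> * Y2)"
    using \<open>\<beta> \<ge> 0\<close> \<open>\<gamma> \<ge> 0\<close> \<open>Y1 > 0\<close> \<open>Y2 \<ge> 0\<close> by simp
  also have "\<dots> = (\<beta> * Y1 + \<gamma> * Y2)\<^sup>2" by (simp add: power2_eq_square algebra_simps)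
  finally have row2: "t * Y2 \<le> \<beta> * Y1 + \<gamma> * Y2"
    by (rule power2_le_imp_le) (use \<open>\<beta> \<ge> 0\<close> \<open>\<gamma> \<ge> 0\<close> \<open>Y1 > 0\<close> \<open>Y2 \<ge> 0\<close> in simp)

  show ?thesis
    using nonneg_matrix_2_radius_bound[OF row1 row2 \<open>Y1 > 0\<close> \<open>s \<ge> 0\<close> \<open>\<beta> \<ge> 0\<close>]
    by (simp add: \<beta>_def)
qed

theorem theorem4p3:
  fixes n :: nat
    and q v :: "nat \<Rightarrow> quat"
    and P\<^sub>r :: "quat poly"
    and w :: "nat \<Rightarrow> real"
    and \<gamma> :: real
    and z :: quat
  assumes "n \<ge> 4"
    and "q 0 = 0"
    and "\<And>j. j \<in> {1..n} \<Longrightarrow> v j = q j * q n - q (j - 1)"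
    and "P\<^sub>r = monom 1 (n + 1) - (\<Sum>j=1..n. monom (v j) (j - 1))"
    and "\<And>j. j \<in> {1..n + 1} \<Longrightarrow> w j > 0"
    and "\<gamma> = Max ((\<lambda>j. w j / w (j + 1)) ` {1..n - 2})"
    and "right_eval P\<^sub>r z = 0"
  shows "norm z \<le>
    1 / 2 * (max (w n / w (n + 1)) (w (n + 1) / w n * norm (v n)) + \<gamma>)
    + sqrt ((max (w n / w (n + 1)) (w (n + 1) / w n * norm (v n)) - \<gamma>)\<^sup>2
        + 4 * (w (n - 1) / w n)
          * sqrt (\<Sum>j=1..n - 1. (norm (v j))\<^sup>2 * (w (n + 1) / w j)\<^sup>2))"
proof -
  define \<alpha> where "\<alpha> = max (w n / w (n + 1)) (w (n + 1) / w n * norm (v n))"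
  define D where "D = (\<alpha> - \<gamma>)\<^sup>2 + 4 * (w (n - 1) / w n)
    * sqrt (\<Sum>j=1..n - 1. (norm (v j))\<^sup>2 * (w (n + 1) / w j)\<^sup>2)"
  have \<gamma>_ge: "w j / w (j + 1) \<le> \<gamma>" if "j \<in> {1..n - 2}" for j
    using that assms(6) by (auto intro!: Max_ge)
  \<comment> \<open>As \<open>n \<ge> 4\<close>, the index 1 occurs in the maximum, which makes
    \<gamma> nonnegative.\<close>
  have "w 1 > 0" "w 2 > 0" using assms(1,5) by auto
  moreover have "w 1 / w 2 \<le> \<gamma>" using \<gamma>_ge[of 1] assms(1) by (simp add: numeral_2_eq_2)
  ultimately have "\<gamma> \<ge> 0" by (meson divide_nonneg_pos less_imp_le order_trans)
  have "z ^ (n + 1) = (\<Sum>j=1..n. z ^ (j - 1) * v j)"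
    using assms(7) by (simp add: assms(4) right_eval_diff right_eval_sum)
  \<comment> \<open>The quaternion norm is multiplicative, so noncommutativity disappears on passing
    to norms.\<close>
  then have "norm z ^ (n + 1) = norm (\<Sum>j=1..n. z ^ (j - 1) * v j)"
    by (metis norm_power)
  also have "\<dots> \<le> (\<Sum>j=1..n. norm z ^ (j - 1) * norm (v j))"
    by (intro order_trans[OF norm_sum]) (simp add: norm_mult norm_power)
  finally have main: "norm z \<le> (\<alpha> + \<gamma> + sqrt D) / 2"
    unfolding \<alpha>_def D_def
    by (intro cauchy_polynomial_bound) (use assms(1,5) \<gamma>_ge \<open>\<gamma> \<ge> 0\<close> in auto)
  have "w n > 0" "w (n - 1) > 0"
    by (intro assms(5); use assms(1) in force)+
  then have "D \<ge> 0" by (simp add: D_def sum_nonneg)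
  from main have "norm z \<le> 1 / 2 * (\<alpha> + \<gamma>) + sqrt D / 2" by (simp add: field_simps)
  \<comment> \<open>In the stated bound the factor 1/2 does not extend to the square root, so it is
    dropped from \<open>sqrt D\<close>.\<close>
  also have "\<dots> \<le> 1 / 2 * (\<alpha> + \<gamma>) + sqrt D" using \<open>D \<ge> 0\<close> by simp
  finally have "norm z \<le> 1 / 2 * (\<alpha> + \<gamma>) + sqrt D" .
  then show ?thesis by (simp only: \<alpha>_def D_def)
qed

end
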